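(* For any positive integer $n_0$, under the pure threshold strategy $\underline{\tilde p}(n_0)$, $$W(n-1,n;\underline{\tilde p}(n_0))\le W(n,n+1;\underline{\tilde p}(n_0))\quad\text{for all integers } 1\le n\le n_0-1.$$ Equivalently, the delay function $W(n;\underline{\tilde p}(n_0))$ is non-decreasing in $n$ for $0\le n\le n_0-1$.
   Context: Model. Customers arrive at a single-server first-come-first-served queue according to a Poisson process with rate $\lambda>0$. When $n\ge 1$ customers are in the system, service is provided at exponential rate $\mu_n$, where $0<\mu_1\le\mu_2\le\cdots$ and $\lim_{n\to\infty}\mu_n=M<\infty$. A strategy is a vector $\underline p=(p_0,p_1,\dots)\in[0,1]^\infty$, where $p_n$ is the probability that a customer who finds $n$ customers upon arrival joins; otherwise she balks. Pure threshold strategy $\underline{\tilde p}(n_0)$: $p_n=1$ for $n\le n_0-1$ and $p_n=0$ for $n\ge n_0$. Delay function. For $0\le n<m$, $W(n,m;\underline p)$ is the expected remaining sojourn time of a tagged customer in the system who has $n$ customers in front of her when there are $m$ customers in total (including her), when all future arrivals follow $\underline p$. That is, it is the expected time until departure of the continuous-time Markov chain started at $(n,m)$ with transitions $(i,k)\to(i,k+1)$ at rate $\lambda p_k$, $(i,k)\to(i-1,k-1)$ at rate $\mu_k$ if $i\ge1$, and $(0,k)\to$ departure at rate $\mu_k$. $W(n;\underline p)=W(n,n+1;\underline p)$ is the expected sojourn time of a customer who finds $n$ customers upon arrival and joins. *)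

theory Defs
  imports "HOL-Probability.Probability"
begin

definition pure_threshold :: "nat \<Rightarrow> nat \<Rightarrow> real" where
  "pure_threshold n0 n = (if n < n0 then 1 else 0)"

text \<open>
  The Markov chain followed by a tagged customer. \<^term>\<open>Some (i, k)\<close> means that she has \<open>i\<close>
  customers in front of her and that \<open>k\<close> customers are in the system, herself included
  (so \<open>i < k\<close>); \<^term>\<open>None\<close> is the absorbing state reached when she departs.
  The rates are \<open>lam * p k\<close> for \<open>(i, k) \<rightarrow> (i, k + 1)\<close> and \<open>mu k\<close> for the service completion.
\<close>

type_synonym state = "(nat \<times> nat) option"

fun total_rate :: "real \<Rightarrow> (nat \<Rightarrow> real) \<Rightarrow> (nat \<Rightarrow> real) \<Rightarrow> state \<Rightarrow> real" where
  "total_rate lam mu p None = 0"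
| "total_rate lam mu p (Some (i, k)) = lam * p k + mu k"

text \<open>
  The jump out of a state, as a function of a mark \<open>u\<close> that is uniform on \<open>[0, 1]\<close>: each possible
  jump is taken with probability (its rate) / (total rate).
\<close>

fun jump :: "real \<Rightarrow> (nat \<Rightarrow> real) \<Rightarrow> (nat \<Rightarrow> real) \<Rightarrow> state \<Rightarrow> real \<Rightarrow> state" where
  "jump lam mu p None u = None"
| "jump lam mu p (Some (i, k)) u =
    (if u < lam * p k / (lam * p k + mu k) then Some (i, k + 1)
     else if i \<ge> 1 then Some (i - 1, k - 1)
     else None)"

text \<open>
  Jump-chain and holding-time construction of the chain. The randomness is an i.i.d. sequence of
  pairs of an Exp(1) variable and an independent uniform mark. A pair \<open>(e, u)\<close> gives the holding
  time \<open>e / q\<close>, which is Exp(\<open>q\<close>) distributed, in a state with total rate \<open>q\<close>, and the next jump.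
\<close>

definition driving_measure :: "(real \<times> real) stream measure" where
  "driving_measure =
    stream_space (density lborel (exponential_density 1) \<Otimes>\<^sub>M uniform_measure lborel {0..1})"

primrec jump_chain ::
  "real \<Rightarrow> (nat \<Rightarrow> real) \<Rightarrow> (nat \<Rightarrow> real) \<Rightarrow> state \<Rightarrow> (real \<times> real) stream \<Rightarrow> nat \<Rightarrow> state" where
  "jump_chain lam mu p x \<omega> 0 = x"
| "jump_chain lam mu p x \<omega> (Suc j) =
    jump lam mu p (jump_chain lam mu p x \<omega> j) (snd (\<omega> !! j))"

text \<open>
  Time until departure: the sum of the holding times in the states visited before \<^term>\<open>None\<close>.
\<close>

definition sojourn_time ::
  "real \<Rightarrow> (nat \<Rightarrow> real) \<Rightarrow> (nat \<Rightarrow> real) \<Rightarrow> state \<Rightarrow> (real \<times> real) stream \<Rightarrow> ennreal" where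
  "sojourn_time lam mu p x \<omega> =
    (\<Sum>j. if jump_chain lam mu p x \<omega> j = None then 0
         else ennreal (fst (\<omega> !! j) / total_rate lam mu p (jump_chain lam mu p x \<omega> j)))"

definition W :: "real \<Rightarrow> (nat \<Rightarrow> real) \<Rightarrow> (nat \<Rightarrow> real) \<Rightarrow> nat \<Rightarrow> nat \<Rightarrow> ennreal" where
  "W lam mu p n m = (\<integral>\<^sup>+ \<omega>. sojourn_time lam mu p (Some (n, m)) \<omega> \<partial>driving_measure)"

definition delay :: "real \<Rightarrow> (nat \<Rightarrow> real) \<Rightarrow> (nat \<Rightarrow> real) \<Rightarrow> nat \<Rightarrow> ennreal" where
  "delay lam mu p n = W lam mu p n (n + 1)"

end

theory Submission
  imports Defs
begin

text \<open>
  Write \<open>W(i, k)\<close> for the delay and set \<open>W(-1, k) = 0\<close>. Subtracting the first-step equations of the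
  states \<open>(i, k)\<close> and \<open>(i - 1, k - 1)\<close> shows that \<open>D(i, k) = W(i, k) - W(i - 1, k - 1)\<close> satisfies
  \<open>(\<lambda> + \<mu>\<^sub>k) D(i, k) = \<lambda> D(i, k + 1) + \<mu>\<^bsub>k-1\<^esub> D(i - 1, k - 1)\<close> for \<open>1 \<le> i < k < n\<^sub>0\<close>, while
  \<open>D(i, n\<^sub>0) = 1 / \<mu>\<^bsub>n\<^sub>0\<^esub>\<close> and \<open>D(0, k) = W(0, k)\<close>. So \<open>D \<ge> 0\<close> by induction on \<open>i\<close> and downwards on \<open>k\<close>.
  The subtraction is legitimate because \<open>(i + 1) / \<mu>\<^sub>1\<close> is a supersolution of the
  first-step equations, which makes \<open>W\<close> finite.
\<close>

section \<open>Law of one driving pair and its two marginals\<close>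

definition mark_measure :: "(real \<times> real) measure" where
  "mark_measure = density lborel (exponential_density 1) \<Otimes>\<^sub>M uniform_measure lborel {0..1}"

lemma driving_measure_eq: "driving_measure = stream_space mark_measure"
  by (simp add: driving_measure_def mark_measure_def)

lemma prob_space_exponential_marks: "prob_space (density lborel (exponential_density 1))"
  by (rule prob_space_exponential_density) simp

lemma prob_space_uniform_marks: "prob_space (uniform_measure lborel {0..1::real})"
  by (rule prob_space_uniform_measure) simp_all

lemma prob_space_mark_measure: "prob_space mark_measure"
proof -
  interpret E: prob_space "density lborel (exponential_density 1)"
    by (rule prob_space_exponential_marks)
  interpret U: prob_space "uniform_measure lborel {0..1::real}"
    by (rule prob_space_uniform_marks)
  interpret pair_prob_space "density lborel (exponential_density 1)"
    "uniform_measure lborel {0..1::real}" ..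
  show ?thesis unfolding mark_measure_def by (rule P.prob_space_axioms)
qed

lemma sets_mark_measure [measurable_cong]:
  "sets mark_measure = sets (borel \<Otimes>\<^sub>M borel)"
  unfolding mark_measure_def by (intro sets_pair_measure_cong) simp_all

lemma nn_integral_mark_fst:
  assumes "f \<in> borel_measurable borel"
  shows "(\<integral>\<^sup>+a. f (fst a) \<partial>mark_measure) = (\<integral>\<^sup>+e. f e \<partial>density lborel (exponential_density 1))"
proof -
  interpret U: prob_space "uniform_measure lborel {0..1::real}"
    by (rule prob_space_uniform_marks)
  note assms [measurable]
  show ?thesis unfolding mark_measure_def
    by (subst U.nn_integral_fst [symmetric]) (auto simp: U.emeasure_space_1[simplified])
qed

lemma nn_integral_mark_snd:
  assumes "f \<in> borel_measurable borel"
  shows "(\<integral>\<^sup>+a. f (snd a) \<partial>mark_measure) = (\<integral>\<^sup>+u. f u \<partial>uniform_measure lborel {0..1})"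
proof -
  interpret U: prob_space "uniform_measure lborel {0..1::real}"
    by (rule prob_space_uniform_marks)
  interpret E: prob_space "density lborel (exponential_density 1)"
    by (rule prob_space_exponential_marks)
  note assms [measurable]
  show ?thesis unfolding mark_measure_def
    by (subst U.nn_integral_fst [symmetric]) (auto simp: E.emeasure_space_1[simplified])
qed

lemma nn_integral_exponential_mean:
  assumes "0 < q"
  shows "(\<integral>\<^sup>+e. ennreal (e / q) \<partial>density lborel (exponential_density 1)) = ennreal (1 / q)"
proof -
  \<comment> \<open>The density vanishes at negative \<open>e\<close>, so the truncation of
    \<open>e / q\<close> at 0 by \<open>ennreal\<close> loses nothing.\<close>
  have "(\<integral>\<^sup>+e. ennreal (e / q) \<partial>density lborel (exponential_density 1))
      = (\<integral>\<^sup>+e. ennreal (1 / q) * ennreal (exponential_density 1 e * e ^ 1) \<partial>lborel)"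
    using assms
    by (subst nn_integral_density)
      (auto intro!: nn_integral_cong simp: exponential_density_def ennreal_mult [symmetric] field_simps)
  also have "\<dots> = ennreal (1 / q) * (\<integral>\<^sup>+e. ennreal (exponential_density 1 e * e ^ 1) \<partial>lborel)"
    by (rule nn_integral_cmult) simp
  also have "(\<integral>\<^sup>+e. ennreal (exponential_density 1 e * e ^ 1) \<partial>lborel) = 1"
    by (subst nn_integral_erlang_ith_moment) simp_all
  finally show ?thesis by simp
qed

text \<open>A uniform mark falls below \<open>a\<close> with probability \<open>a\<close>; this
  turns the threshold test in \<open>jump\<close> into jump probabilities.\<close>

lemma nn_integral_uniform_if:
  fixes A B :: ennreal
  assumes "0 \<le> a" "a \<le> 1"
  shows "(\<integral>\<^sup>+u. (if u < a then A else B) \<partial>uniform_measure lborel {0..1})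
    = ennreal a * A + ennreal (1 - a) * B"
proof -
  have "(\<integral>\<^sup>+u. (if u < a then A else B) \<partial>uniform_measure lborel {0..1})
      = (\<integral>\<^sup>+u. (if u < a then A else B) * indicator {0..1} u \<partial>lborel)"
    by (subst nn_integral_uniform_measure) (simp_all add: divide_ennreal_def)
  also have "\<dots> = (\<integral>\<^sup>+u. A * indicator {0..<a} u + B * indicator {a..1} u \<partial>lborel)"
    using assms by (intro nn_integral_cong) (auto simp: indicator_def)
  also have "\<dots> = A * ennreal a + B * ennreal (1 - a)"
    using assms by (subst nn_integral_add) (simp_all add: nn_integral_cmult_indicator)
  finally show ?thesis by (simp add: mult.commute)
qed

section \<open>The jump chain: measurability, shift, and expected holding times\<close>

lemma measurable_jump [measurable]:
  "jump lam mu p x \<in> borel \<rightarrow>\<^sub>M count_space UNIV"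
proof (cases x)
  case None
  then have "jump lam mu p x = (\<lambda>u. None)" by auto
  then show ?thesis by simp
next
  case (Some s)
  then obtain i k where "x = Some (i, k)" by (cases s) auto
  then have "jump lam mu p x = (\<lambda>u. if u < lam * p k / (lam * p k + mu k) then Some (i, k + 1)
     else if i \<ge> 1 then Some (i - 1, k - 1) else None)" by auto
  then show ?thesis by simp
qed

lemma measurable_jump_chain [measurable]:
  "(\<lambda>\<omega>. jump_chain lam mu p x \<omega> j) \<in> stream_space mark_measure \<rightarrow>\<^sub>M count_space UNIV"
proof (induction j)
  case 0
  then show ?case by simp
next
  case (Suc j)
  \<comment> \<open>The state space is countable, so it suffices to treat a fixed current state
    \<open>y\<close>.\<close>
  have "(\<lambda>\<omega>. jump lam mu p y (snd (\<omega> !! j))) \<in> stream_space mark_measure \<rightarrow>\<^sub>M count_space UNIV"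
    for y
    by measurable
  from measurable_compose_countable [OF this Suc] show ?case by simp
qed

text \<open>Pathwise Markov property: the first pair only selects a new starting state, and the tail
  of the stream drives the chain from there.\<close>

lemma jump_chain_Suc_SCons:
  "jump_chain lam mu p x (a ## \<omega>) (Suc j) = jump_chain lam mu p (jump lam mu p x (snd a)) \<omega> j"
  by (induction j) simp_all

text \<open>The \<open>j\<close>-th summand of \<open>sojourn_time\<close>, isolated so that
  expectations can be taken term by term.\<close>

definition holding_time ::
  "real \<Rightarrow> (nat \<Rightarrow> real) \<Rightarrow> (nat \<Rightarrow> real) \<Rightarrow> nat \<Rightarrow> state \<Rightarrow> (real \<times> real) stream \<Rightarrow> ennreal" where
  "holding_time lam mu p j x \<omega> =
    (if jump_chain lam mu p x \<omega> j = None then 0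
     else ennreal (fst (\<omega> !! j) / total_rate lam mu p (jump_chain lam mu p x \<omega> j)))"

definition mean_holding_time ::
  "real \<Rightarrow> (nat \<Rightarrow> real) \<Rightarrow> (nat \<Rightarrow> real) \<Rightarrow> nat \<Rightarrow> state \<Rightarrow> ennreal" where
  "mean_holding_time lam mu p j x = (\<integral>\<^sup>+\<omega>. holding_time lam mu p j x \<omega> \<partial>driving_measure)"

lemma measurable_holding_time [measurable]:
  "holding_time lam mu p j x \<in> borel_measurable (stream_space mark_measure)"
proof -
  have "(\<lambda>\<omega>. if y = None then 0 else ennreal (fst (\<omega> !! j) / total_rate lam mu p y))
      \<in> borel_measurable (stream_space mark_measure)" for y
    by measurable
  from measurable_compose_countable [OF this measurable_jump_chain]
  show ?thesis unfolding holding_time_def [abs_def] by simp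
qed

lemma holding_time_Suc_SCons:
  "holding_time lam mu p (Suc j) x (a ## \<omega>) = holding_time lam mu p j (jump lam mu p x (snd a)) \<omega>"
  unfolding holding_time_def jump_chain_Suc_SCons by simp

lemma mean_holding_time_None [simp]: "mean_holding_time lam mu p j None = 0"
proof -
  have "jump_chain lam mu p None \<omega> j = None" for \<omega>
    by (induction j) simp_all
  then show ?thesis by (simp add: mean_holding_time_def holding_time_def)
qed

lemma mean_holding_time_0:
  assumes "0 < lam * p k + mu k"
  shows "mean_holding_time lam mu p 0 (Some (i, k)) = ennreal (1 / (lam * p k + mu k))"
proof -
  interpret prob_space mark_measure by (rule prob_space_mark_measure)
  interpret S: prob_space "stream_space mark_measure" by (rule prob_space_stream_space)
  have "mean_holding_time lam mu p 0 (Some (i, k))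
      = (\<integral>\<^sup>+a. \<integral>\<^sup>+\<omega>. holding_time lam mu p 0 (Some (i, k)) (a ## \<omega>) \<partial>stream_space mark_measure \<partial>mark_measure)"
    unfolding mean_holding_time_def driving_measure_eq by (rule nn_integral_stream_space) measurable
  also have "\<dots> = (\<integral>\<^sup>+a. ennreal (fst a / (lam * p k + mu k)) \<partial>mark_measure)"
    by (simp add: holding_time_def S.emeasure_space_1)
  also have "\<dots> = ennreal (1 / (lam * p k + mu k))"
    by (subst nn_integral_mark_fst) (simp_all add: nn_integral_exponential_mean assms)
  finally show ?thesis .
qed

abbreviation after_service :: "nat \<Rightarrow> nat \<Rightarrow> state" where
  "after_service i k \<equiv> (if i \<ge> 1 then Some (i - 1, k - 1) else None)"

text \<open>Condition on the first pair: its mark decides the next state, and the remaining pairs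
  form a stream with the same law.\<close>

lemma mean_holding_time_Suc:
  assumes "0 \<le> lam * p k" "0 < mu k"
  shows "mean_holding_time lam mu p (Suc j) (Some (i, k))
    = ennreal (lam * p k / (lam * p k + mu k)) * mean_holding_time lam mu p j (Some (i, k + 1))
    + ennreal (mu k / (lam * p k + mu k)) * mean_holding_time lam mu p j (after_service i k)"
proof -
  interpret prob_space mark_measure by (rule prob_space_mark_measure)
  let ?a = "lam * p k / (lam * p k + mu k)" and ?h = "mean_holding_time lam mu p j"
  have a: "0 \<le> ?a" "?a \<le> 1" "1 - ?a = mu k / (lam * p k + mu k)"
    using assms by (simp_all add: field_simps)
  have [measurable]: "(\<lambda>u. ?h (jump lam mu p (Some (i, k)) u)) \<in> borel_measurable borel"
    by (rule measurable_compose [OF measurable_jump]) simp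
  have "mean_holding_time lam mu p (Suc j) (Some (i, k))
      = (\<integral>\<^sup>+a. \<integral>\<^sup>+\<omega>. holding_time lam mu p (Suc j) (Some (i, k)) (a ## \<omega>) \<partial>stream_space mark_measure \<partial>mark_measure)"
    unfolding mean_holding_time_def driving_measure_eq by (rule nn_integral_stream_space) measurable
  also have "\<dots> = (\<integral>\<^sup>+a. ?h (jump lam mu p (Some (i, k)) (snd a)) \<partial>mark_measure)"
    by (simp only: holding_time_Suc_SCons mean_holding_time_def driving_measure_eq)
  also have "\<dots> = (\<integral>\<^sup>+u. ?h (jump lam mu p (Some (i, k)) u) \<partial>uniform_measure lborel {0..1})"
    by (rule nn_integral_mark_snd) measurable
  also have "\<dots> = (\<integral>\<^sup>+u. (if u < ?a then ?h (Some (i, k + 1)) else ?h (after_service i k))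
      \<partial>uniform_measure lborel {0..1})"
    by (intro nn_integral_cong) auto
  also have "\<dots> = ennreal ?a * ?h (Some (i, k + 1)) + ennreal (1 - ?a) * ?h (after_service i k)"
    by (rule nn_integral_uniform_if [OF a(1,2)])
  finally show ?thesis unfolding a(3) .
qed

section \<open>First-step equations for the delay\<close>

lemma W_eq_suminf: "W lam mu p i k = (\<Sum>j. mean_holding_time lam mu p j (Some (i, k)))"
  unfolding W_def sojourn_time_def mean_holding_time_def driving_measure_eq
  by (subst nn_integral_suminf [symmetric]) (simp_all add: holding_time_def)

text \<open>Split off the first holding time and sum the recursion of
  \<open>mean_holding_time\<close> over \<open>j\<close>. In \<open>ennreal\<close> this is valid
  even if the sums are infinite.\<close>

lemma W_first_step:
  assumes "0 \<le> lam * p k" "0 < mu k"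
  shows "W lam mu p i k = ennreal (1 / (lam * p k + mu k))
    + ennreal (lam * p k / (lam * p k + mu k)) * W lam mu p i (k + 1)
    + ennreal (mu k / (lam * p k + mu k)) * (if i = 0 then 0 else W lam mu p (i - 1) (k - 1))"
proof -
  let ?h = "mean_holding_time lam mu p"
  have "W lam mu p i k = ?h 0 (Some (i, k)) + (\<Sum>j. ?h (Suc j) (Some (i, k)))"
    unfolding W_eq_suminf using suminf_offset [OF summableI, of "\<lambda>j. ?h j (Some (i, k))" 1] by simp
  also have "(\<Sum>j. ?h (Suc j) (Some (i, k)))
      = ennreal (lam * p k / (lam * p k + mu k)) * W lam mu p i (k + 1)
      + ennreal (mu k / (lam * p k + mu k)) * (\<Sum>j. ?h j (after_service i k))"
    by (simp only: mean_holding_time_Suc [where lam=lam and mu=mu and p=p and k=k, OF assms] suminf_add [symmetric] summableI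
        ennreal_suminf_cmult W_eq_suminf)
  also have "(\<Sum>j. ?h j (after_service i k)) = (if i = 0 then 0 else W lam mu p (i - 1) (k - 1))"
    by (simp add: W_eq_suminf)
  also have "?h 0 (Some (i, k)) = ennreal (1 / (lam * p k + mu k))"
    using assms by (intro mean_holding_time_0) simp
  finally show ?thesis by (simp only: add.assoc)
qed

section \<open>Finiteness of the delay\<close>

text \<open>Every partial sum of expected holding times lies below the supersolution, by induction
  on its length \<open>J\<close>. The bound does not depend on \<open>k\<close>, so arrivals leave
  it unchanged, while a service lowers it by \<open>1 / c\<close>. The invariant
  \<open>i < k\<close> keeps \<open>k\<close> positive, where \<open>mu k\<close> is at least
  \<open>c\<close>.\<close>

lemma W_le:
  assumes "\<And>k. 0 \<le> lam * p k" and "0 < c" and "\<And>k. 1 \<le> k \<Longrightarrow> c \<le> mu k" and "i < k"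
  shows "W lam mu p i k \<le> ennreal ((real i + 1) / c)"
proof -
  let ?h = "mean_holding_time lam mu p"
  have "(\<Sum>j<J. ?h j (Some (i, k))) \<le> ennreal ((real i + 1) / c)" if "i < k" for J i k
    using that
  proof (induction J arbitrary: i k)
    case 0
    then show ?case by simp
  next
    case (Suc J)
    define q where "q = lam * p k + mu k"
    have mu: "c \<le> mu k" "0 < mu k" using assms(2) assms(3) [of k] Suc.prems by auto
    have q: "0 < q" using mu assms(1) [of k] by (simp add: q_def)
    \<comment> \<open>For \<open>i = 0\<close> the tagged customer has departed and both sides are
      0.\<close>
    have down: "(\<Sum>j<J. ?h j (after_service i k)) \<le> ennreal (real i / c)"
      using Suc.IH [of "i - 1" "k - 1"] Suc.prems by (cases i) (auto simp: add.commute)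
    have "(\<Sum>j<Suc J. ?h j (Some (i, k))) = ?h 0 (Some (i, k)) + (\<Sum>j<J. ?h (Suc j) (Some (i, k)))"
      by (rule sum.lessThan_Suc_shift)
    also have "\<dots> = ennreal (1 / q)
        + (ennreal (lam * p k / q) * (\<Sum>j<J. ?h j (Some (i, k + 1)))
        + ennreal (mu k / q) * (\<Sum>j<J. ?h j (after_service i k)))"
      using q unfolding q_def
      by (simp only: mean_holding_time_0 mean_holding_time_Suc [where lam=lam and mu=mu and p=p and k=k, OF assms(1) mu(2)]
          sum.distrib sum_distrib_left)
    also have "\<dots> \<le> ennreal (1 / q)
        + (ennreal (lam * p k / q) * ennreal ((real i + 1) / c) + ennreal (mu k / q) * ennreal (real i / c))"
      using Suc.IH [of i "k + 1"] Suc.prems down by (intro add_mono mult_left_mono) auto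
    also have "\<dots> = ennreal (1 / q + (lam * p k / q * ((real i + 1) / c) + mu k / q * (real i / c)))"
      using assms(1) [of k] assms(2) mu q
      by (simp add: ennreal_mult [symmetric] ennreal_plus [symmetric] del: ennreal_plus)
    also have "\<dots> \<le> ennreal ((real i + 1) / c)"
    proof (rule ennreal_leI)
      have "1 / q + (lam * p k / q * ((real i + 1) / c) + mu k / q * (real i / c))
          = (c + lam * p k * (real i + 1) + mu k * real i) / (q * c)"
        using q assms(2) by (simp add: field_simps)
      \<comment> \<open>After expanding \<open>q\<close>, the numerators compare exactly because
        \<open>c \<le> mu k\<close>.\<close>
      also have "\<dots> \<le> (q * (real i + 1)) / (q * c)"
        using mu mult_pos_pos [OF q assms(2)]
        by (intro divide_right_mono) (simp add: q_def algebra_simps, simp)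
      also have "\<dots> = (real i + 1) / c" using q by simp
      finally show "1 / q + (lam * p k / q * ((real i + 1) / c) + mu k / q * (real i / c))
          \<le> (real i + 1) / c" .
    qed
    finally show ?case .
  qed
  then show ?thesis
    unfolding W_eq_suminf using assms(4) by (intro suminf_le_const summableI) auto
qed

section \<open>Monotonicity under a threshold strategy\<close>

text \<open>All \<open>k\<close> up to \<open>n0\<close> are covered, not only
  \<open>k = i + 1\<close>, because an arrival leads from \<open>(i, k)\<close> to
  \<open>(i, k + 1)\<close> and the induction must follow it.\<close>

lemma W_threshold_mono:
  fixes lam :: real and mu :: "nat \<Rightarrow> real"
  assumes lam: "0 < lam" and c: "0 < c" "\<And>k. 1 \<le> k \<Longrightarrow> c \<le> mu k"
    and "1 \<le> i" "i < k" "k \<le> n0"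
  shows "W lam mu (pure_threshold n0) (i - 1) (k - 1) \<le> W lam mu (pure_threshold n0) i k"
proof -
  define p where "p = pure_threshold n0"
  define w where "w i k = enn2real (W lam mu p i k)" for i k
  have p: "0 \<le> lam * p k" for k using lam by (simp add: p_def pure_threshold_def)
  have mu: "0 < mu k" if "1 \<le> k" for k using c that by (meson less_le_trans)
  have W: "W lam mu p i k = ennreal (w i k)" if "i < k" for i k
    using W_le [where lam=lam and mu=mu and p=p, OF p c that] unfolding w_def
    by (metis ennreal_enn2real ennreal_less_top le_less_trans)
  have w_nonneg: "0 \<le> w i k" for i k by (simp add: w_def)
  have first_step: "(lam * p k + mu k) * w i k
      = 1 + lam * p k * w i (k + 1) + mu k * (if i = 0 then 0 else w (i - 1) (k - 1))"
    if "i < k" for i k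
  proof -
    define q d where "q = lam * p k + mu k" and "d = (if i = 0 then 0 else w (i - 1) (k - 1))"
    have q: "0 < q" and m: "0 < mu k" using mu [of k] p [of k] that by (auto simp: q_def)
    have d: "0 \<le> d" "(if i = 0 then 0 else W lam mu p (i - 1) (k - 1)) = ennreal d"
      using that W [of "i - 1" "k - 1"] w_nonneg by (auto simp: d_def)
    have "ennreal (w i k) = ennreal (1 / q) + ennreal (lam * p k / q) * ennreal (w i (k + 1))
        + ennreal (mu k / q) * ennreal d"
      using W_first_step [where lam=lam and mu=mu and p=p and i=i and k=k, OF p m] W [OF that] W [of i "k + 1"] that
      unfolding d(2) q_def by simp
    also have "\<dots> = ennreal (1 / q + lam * p k / q * w i (k + 1) + mu k / q * d)"
      using p [of k] q m d(1) w_nonneg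
      by (simp add: ennreal_mult [symmetric] ennreal_plus [symmetric] del: ennreal_plus)
    finally have "w i k = 1 / q + lam * p k / q * w i (k + 1) + mu k / q * d"
      using p [of k] q m d(1) w_nonneg by (subst (asm) ennreal_inj) auto
    then show ?thesis using q unfolding q_def [symmetric] d_def [symmetric] by (simp add: field_simps)
  qed
  have "w (i - 1) (k - 1) \<le> w i k" if "1 \<le> i" "i < k" "k \<le> n0" for i k
    using that
  proof (induction i arbitrary: k rule: less_induct)
    case (less i)
    \<comment> \<open>Downward induction from \<open>n0\<close>. The condition \<open>i < k\<close>
      stays inside the induction claim; it passes from \<open>k\<close> to \<open>k + 1\<close>,
      where the induction hypothesis is used.\<close>
    have "k \<le> n0 \<Longrightarrow> i < k \<longrightarrow> w (i - 1) (k - 1) \<le> w i k" for k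
    proof (induction k rule: inc_induct)
      case base
      show ?case
      proof
        \<comment> \<open>At \<open>n0\<close> nobody joins, so the next event is a service and the
          difference is the mean service time \<open>1 / mu n0\<close>.\<close>
        assume "i < n0"
        then have "mu n0 * w i n0 = 1 + mu n0 * w (i - 1) (n0 - 1)"
          using first_step [of i n0] less.prems(1) by (simp add: p_def pure_threshold_def)
        then have "mu n0 * w (i - 1) (n0 - 1) \<le> mu n0 * w i n0" by simp
        then show "w (i - 1) (n0 - 1) \<le> w i n0" using mu [of n0] \<open>i < n0\<close> by simp
      qed
    next
      case (step k)
      show ?case
      proof
        assume "i < k"
        let ?d = "if i - 1 = 0 then 0 else w (i - 1 - 1) (k - 1 - 1)"
        \<comment> \<open>Since \<open>k < n0\<close>, both states have arrival rate
          \<open>lam\<close>, so their arrival terms can be paired.\<close>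
        have k: "p k = 1" "p (k - 1) = 1" using step.hyps by (auto simp: p_def pure_threshold_def)
        have eq1: "(lam + mu k) * w i k = 1 + lam * w i (k + 1) + mu k * w (i - 1) (k - 1)"
          using first_step [of i k] \<open>i < k\<close> less.prems(1) k by simp
        have eq2: "(lam + mu (k - 1)) * w (i - 1) (k - 1) = 1 + lam * w (i - 1) k + mu (k - 1) * ?d"
          using first_step [of "i - 1" "k - 1"] \<open>i < k\<close> less.prems(1) k by simp
        have up: "w (i - 1) k \<le> w i (k + 1)" using step.IH \<open>i < k\<close> by simp
        \<comment> \<open>For \<open>i = 1\<close> this is nonnegativity of \<open>w\<close>;
          otherwise it is the outer hypothesis at \<open>(i - 1, k - 1)\<close>.\<close>
        have down: "?d \<le> w (i - 1) (k - 1)"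
          using less.IH [of "i - 1" "k - 1"] \<open>i < k\<close> less.prems(1) step.hyps w_nonneg by auto
        \<comment> \<open>The \<open>mu k\<close> terms cancel, and \<open>eq2\<close> replaces the
          constant 1; what remains are two nonnegative differences with nonnegative weights.\<close>
        have "(lam + mu k) * (w i k - w (i - 1) (k - 1))
            = lam * (w i (k + 1) - w (i - 1) k) + mu (k - 1) * (w (i - 1) (k - 1) - ?d)"
          using eq1 eq2 by (simp add: algebra_simps)
        also have "\<dots> \<ge> 0"
          using up down lam less_imp_le [OF mu, of "k - 1"] \<open>i < k\<close> less.prems(1)
          by (intro add_nonneg_nonneg mult_nonneg_nonneg) simp_all
        finally show "w (i - 1) (k - 1) \<le> w i k"
          using lam mu [of k] \<open>i < k\<close> by (simp add: zero_le_mult_iff)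
      qed
    qed
    with less.prems show ?case by blast
  qed
  from this [OF assms(4-6)] show ?thesis
    using W [of i k] W [of "i - 1" "k - 1"] assms(4-6) unfolding p_def [symmetric]
    by (simp add: ennreal_leI)
qed

theorem mainTheorem3:
  fixes lam M :: real and mu :: "nat \<Rightarrow> real" and n0 :: nat
  assumes "0 < lam"
    and "0 < mu 1"
    and "\<And>n. 1 \<le> n \<Longrightarrow> mu n \<le> mu (n + 1)"
    and "mu \<longlonglongrightarrow> M"
    and "1 \<le> n0"
  shows "(\<forall>n. 1 \<le> n \<and> n \<le> n0 - 1 \<longrightarrow>
            W lam mu (pure_threshold n0) (n - 1) n \<le> W lam mu (pure_threshold n0) n (n + 1))
       \<and> mono_on {0..n0 - 1} (delay lam mu (pure_threshold n0))"
proof -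
  \<comment> \<open>The slowest rate \<open>mu 1\<close> serves as the lower bound
    \<open>c\<close>.\<close>
  have mu: "mu 1 \<le> mu k" if "1 \<le> k" for k
    using that by (induction k rule: dec_induct) (use assms(3) in \<open>force intro: order_trans\<close>)+
  have adjacent: "W lam mu (pure_threshold n0) (n - 1) n \<le> W lam mu (pure_threshold n0) n (n + 1)"
    if "1 \<le> n" "n \<le> n0 - 1" for n
    using W_threshold_mono [where lam=lam and mu=mu and i=n and k="n + 1", OF assms(1,2) mu] that by simp
  have "delay lam mu (pure_threshold n0) m \<le> delay lam mu (pure_threshold n0) n"
    if "m \<le> n" "n \<le> n0 - 1" for m n
    using that
  proof (induction n rule: dec_induct)
    case base
    show ?case by simp
  next
    case (step n)
    \<comment> \<open>\<open>adjacent\<close> at \<open>Suc n\<close> compares \<open>delay\<close>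
      at \<open>n\<close> with \<open>delay\<close> at \<open>Suc n\<close>.\<close>
    then show ?case
      using adjacent [of "Suc n"] by (simp add: delay_def)
  qed
  with adjacent show ?thesis by (auto intro!: mono_onI)
qed

end
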